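(* Let $C_n$ be an $n$-cycle, where $n\ge3$. Then, for real $k$, $$\dim_f^k(C_n)=k\dim_f(C_n)=\begin{cases}\frac{kn}{n-2} & \text{if } n \text{ is even and } k\in[1,n-2],\\ \frac{kn}{n-1} & \text{if } n \text{ is odd and } k\in[1,n-1].\end{cases}$$
   Context: For a finite simple connected graph $G$ with at least two vertices, $d(x,y)$ is the length of a shortest path between $x$ and $y$. For distinct $x,y\in V(G)$, let $R\{x,y\}=\{z\in V(G): d(x,z)\neq d(y,z)\}$, and let $\kappa(G)=\min\{|R\{x,y\}|: x\neq y,\ x,y\in V(G)\}$. For a function $g$ on $V(G)$ and $U\subseteq V(G)$, write $g(U)=\sum_{s\in U}g(s)$. For a real number $k\in[1,\kappa(G)]$, a function $g:V(G)\to[0,1]$ is a $k$-resolving function of $G$ if $g(R\{x,y\})\ge k$ for any two distinct vertices $x,y\in V(G)$; the fractional $k$-metric dimension is $\dim_f^k(G)=\min\{g(V(G)): g \text{ is a } k\text{-resolving function of } G\}$. The fractional metric dimension is $\dim_f(G)=\dim_f^1(G)$. *)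

theory Defs
  imports Complex_Main "Graph_Theory.Graph_Theory"
begin

text \<open>Simple graphs are symmetric loop-free digraphs without parallel arcs, as in
  \<^locale>\<open>pair_graph\<close>: an undirected edge is a pair of opposite arcs. The definitions below are
  intended for connected graphs with at least two vertices. In particular, \<open>LEAST\<close> in
  \<open>graph_dist\<close> carries no information when there is no path.\<close>

definition graph_dist :: "'a pair_pre_digraph \<Rightarrow> 'a \<Rightarrow> 'a \<Rightarrow> nat" where
  "graph_dist G x y = (LEAST l. \<exists>p. pre_digraph.apath (with_proj G) x p y \<and> length p = l)"

definition resolving_set :: "'a pair_pre_digraph \<Rightarrow> 'a \<Rightarrow> 'a \<Rightarrow> 'a set" where
  "resolving_set G x y = {z \<in> pverts G. graph_dist G x z \<noteq> graph_dist G y z}"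

definition kappa :: "'a pair_pre_digraph \<Rightarrow> nat" where
  "kappa G = Min {card (resolving_set G x y) | x y. x \<in> pverts G \<and> y \<in> pverts G \<and> x \<noteq> y}"

text \<open>The range of \<open>k\<close> is part of the notion: outside \<open>[1, \<kappa>(G)]\<close> there is no
  \<open>k\<close>-resolving function. Values of \<open>g\<close> outside the vertex set are irrelevant.\<close>

definition k_resolving_function :: "'a pair_pre_digraph \<Rightarrow> real \<Rightarrow> ('a \<Rightarrow> real) \<Rightarrow> bool" where
  "k_resolving_function G k g \<longleftrightarrow>
     k \<in> {1..real (kappa G)} \<and>
     (\<forall>v \<in> pverts G. g v \<in> {0..1}) \<and>
     (\<forall>x \<in> pverts G. \<forall>y \<in> pverts G. x \<noteq> y \<longrightarrow> sum g (resolving_set G x y) \<ge> k)"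

text \<open>\<open>LEAST\<close> on the reals is a minimum, not an infimum: it is determined only if the bound
  is attained.\<close>

definition frac_k_metric_dim :: "'a pair_pre_digraph \<Rightarrow> real \<Rightarrow> real" where
  "frac_k_metric_dim G k =
     (LEAST r. \<exists>g. k_resolving_function G k g \<and> r = sum g (pverts G))"

definition frac_metric_dim :: "'a pair_pre_digraph \<Rightarrow> real" where
  "frac_metric_dim G = frac_k_metric_dim G 1"

definition is_n_cycle :: "nat \<Rightarrow> 'a pair_pre_digraph \<Rightarrow> bool" where
  "is_n_cycle n G \<longleftrightarrow>
     pair_graph G \<and>
     (\<exists>v. bij_betw v {..<n} (pverts G) \<and>
          parcs G = (\<Union>i<n. {(v i, v (Suc i mod n)), (v (Suc i mod n), v i)}))"

end

theory Submission
  imports Defs "HOL-Number_Theory.Cong"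
begin

text \<open>Index the vertices of the cycle by the integers modulo \<open>n\<close>. The distance between \<open>i\<close> and \<open>j\<close>
  is a function of \<open>j - i\<close> whose fibres are the classes \<open>\<plusminus>a\<close>, so \<open>z\<close> fails to resolve
  \<open>i \<noteq> j\<close> iff \<open>2 z = i + j\<close>. This equation has no solution or exactly \<open>gcd 2 n\<close> of them, hence
  \<open>\<kappa> = n - gcd 2 n\<close>. The constant function \<open>k / \<kappa>\<close> is \<open>k\<close>-resolving. Conversely, adding up the
  inequalities for the \<open>n\<close> pairs \<open>{i - 1, i + 1}\<close> counts each vertex \<open>\<kappa>\<close> times, which bounds
  the weight of every \<open>k\<close>-resolving function from below by \<open>k n / \<kappa>\<close>.\<close>

section \<open>Fractional dimension by double counting\<close>

lemma finite_card_resolving_sets: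
  assumes "finite (pverts G)"
  shows "finite {card (resolving_set G x y) | x y. x \<in> pverts G \<and> y \<in> pverts G \<and> x \<noteq> y}"
proof (rule finite_subset)
  show "{card (resolving_set G x y) | x y. x \<in> pverts G \<and> y \<in> pverts G \<and> x \<noteq> y}
      \<subseteq> (\<lambda>(x, y). card (resolving_set G x y)) ` (pverts G \<times> pverts G)"
    by auto
qed (use assms in simp)

lemma kappa_le_card_resolving_set:
  assumes "finite (pverts G)" "x \<in> pverts G" "y \<in> pverts G" "x \<noteq> y"
  shows "kappa G \<le> card (resolving_set G x y)"
  unfolding kappa_def
  by (rule Min_le[OF finite_card_resolving_sets[OF assms(1)]]) (use assms(2-) in blast)

text \<open>The pairs form an indexed family so that repetitions count: in the 4-cycle, two indices
  give the same unordered pair of neighbours. As many pairs as vertices, with every vertex resolving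
  exactly \<open>kappa G\<close> of them, make the averaged lower bound meet the weight of the
  constant function.\<close>

lemma frac_k_metric_dim_eq:
  fixes x y :: "'i \<Rightarrow> 'a"
  assumes fin: "finite (pverts G)" "finite I"
    and pairs: "\<And>i. i \<in> I \<Longrightarrow> x i \<in> pverts G \<and> y i \<in> pverts G \<and> x i \<noteq> y i"
    and card_I: "card I = card (pverts G)"
    and regular: "\<And>w. w \<in> pverts G \<Longrightarrow>
      card {i \<in> I. w \<in> resolving_set G (x i) (y i)} = kappa G"
    and k: "k \<in> {1..real (kappa G)}"
  shows "frac_k_metric_dim G k = k * card (pverts G) / kappa G"
  unfolding frac_k_metric_dim_def
proof (rule Least_equality)
  have pos: "real (kappa G) > 0" using k by auto
  let ?g = "\<lambda>_ :: 'a. k / kappa G"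
  have "sum ?g (resolving_set G a b) \<ge> k"
    if "a \<in> pverts G" "b \<in> pverts G" "a \<noteq> b" for a b
  proof -
    have "k = real (kappa G) * (k / kappa G)" using pos by simp
    also have "\<dots> \<le> real (card (resolving_set G a b)) * (k / kappa G)"
      using kappa_le_card_resolving_set[OF fin(1) that] k by (intro mult_right_mono) auto
    finally show ?thesis by simp
  qed
  then have "k_resolving_function G k ?g"
    using k pos by (auto simp: k_resolving_function_def)
  then show "\<exists>g. k_resolving_function G k g \<and>
      k * card (pverts G) / kappa G = sum g (pverts G)"
    by (intro exI[of _ ?g]) auto
next
  fix r
  assume "\<exists>g. k_resolving_function G k g \<and> r = sum g (pverts G)"
  then obtain g where g: "k_resolving_function G k g" and r: "r = sum g (pverts G)" by blast
  have pos: "real (kappa G) > 0" using k by auto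
  have "k * card (pverts G) = (\<Sum>i\<in>I. k)" by (simp add: card_I)
  also have "\<dots> \<le> (\<Sum>i\<in>I. sum g (resolving_set G (x i) (y i)))"
    using g pairs by (intro sum_mono) (auto simp: k_resolving_function_def)
  \<comment> \<open>Each resolving set becomes a filter on the vertices, so the two summations can
    be exchanged.\<close>
  also have "\<dots> = (\<Sum>i\<in>I. \<Sum>w | w \<in> pverts G \<and> w \<in> resolving_set G (x i) (y i). g w)"
    by (intro sum.cong refl) (auto simp: resolving_set_def)
  also have "\<dots> = (\<Sum>w\<in>pverts G. \<Sum>i | i \<in> I \<and> w \<in> resolving_set G (x i) (y i). g w)"
    using fin by (intro sum.swap_restrict) auto
  also have "\<dots> = (\<Sum>w\<in>pverts G. kappa G * g w)"
    by (intro sum.cong refl) (simp add: regular)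
  also have "\<dots> = kappa G * r"
    by (simp add: r sum_distrib_left)
  finally show "k * card (pverts G) / kappa G \<le> r"
    using pos by (simp add: field_simps)
qed

section \<open>Distances in a cycle\<close>

text \<open>Cutting out a closed subwalk shortens a walk that repeats a vertex. Distances, defined
  through paths, can thus be estimated by arbitrary walks.\<close>

lemma (in wf_digraph) awalk_imp_shorter_apath:
  assumes "awalk a p b"
  shows "\<exists>q. apath a q b \<and> length q \<le> length p"
  using assms
proof (induction p rule: length_induct)
  case (1 p)
  show ?case
  proof (cases "distinct (awalk_verts a p)")
    case True
    then show ?thesis using 1 by (auto simp: apath_def)
  next
    case False
    then obtain q r s w where p: "p = q @ r @ s" "0 < length r" "awalk a q w" "awalk w s b"
      using awalk_not_distinct_decomp[OF 1(2)] by blast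
    then have "awalk a (q @ s) b" "length (q @ s) < length p" by (auto intro: awalk_appendI)
    then show ?thesis using 1(1) by (meson less_or_eq_imp_le order_trans)
  qed
qed

text \<open>For n > 0 this is the least absolute value in the residue class of a. The disjunction
  makes the sign symmetry immediate and avoids asking which way round is shorter.\<close>

definition cycle_dist :: "int \<Rightarrow> int \<Rightarrow> nat" where
  "cycle_dist n a = (LEAST l. [a = int l] (mod n) \<or> [a = - int l] (mod n))"

lemma cycle_dist_attained:
  assumes "n > 0"
  shows "[a = int (cycle_dist n a)] (mod n) \<or> [a = - int (cycle_dist n a)] (mod n)"
  unfolding cycle_dist_def
proof (rule LeastI)
  show "[a = int (nat (a mod n))] (mod n) \<or> [a = - int (nat (a mod n))] (mod n)"
    using assms by (simp add: cong_def)
qed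

lemma cycle_dist_le:
  assumes "[a = t] (mod n)"
  shows "cycle_dist n a \<le> nat \<bar>t\<bar>"
  unfolding cycle_dist_def using assms by (intro Least_le) (auto simp: abs_if)

lemma cycle_dist_cong:
  assumes "[a = b] (mod n)"
  shows "cycle_dist n a = cycle_dist n b"
  using assms by (simp add: cycle_dist_def cong_def)

lemma cycle_dist_minus: "cycle_dist n (- a) = cycle_dist n a"
proof -
  have "[- a = b] (mod n) \<longleftrightarrow> [a = - b] (mod n)" for b
    using cong_minus_minus_iff[of a "- b" n] by simp
  then show ?thesis by (auto simp: cycle_dist_def intro!: arg_cong[where f = Least])
qed

lemma cycle_dist_eq_iff:
  assumes "n > 0"
  shows "cycle_dist n a = cycle_dist n b \<longleftrightarrow> [a = b] (mod n) \<or> [a = - b] (mod n)"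
proof
  assume eq: "cycle_dist n a = cycle_dist n b"
  let ?l = "int (cycle_dist n a)"
  have a: "[a = ?l] (mod n) \<or> [a = - ?l] (mod n)"
    using cycle_dist_attained[OF assms] .
  have "[b = ?l] (mod n) \<or> [b = - ?l] (mod n)"
    using cycle_dist_attained[OF assms] unfolding eq .
  \<comment> \<open>The signs for a and b are independent; this fact and its negated form cover all
    four combinations.\<close>
  then have b: "[?l = b] (mod n) \<or> [?l = - b] (mod n)"
    using cong_minus_minus_iff[of b "- ?l" n] by (auto simp: cong_sym_eq)
  then have "[- ?l = - b] (mod n) \<or> [- ?l = b] (mod n)"
    using cong_minus_minus_iff[of ?l b n] cong_minus_minus_iff[of ?l "- b" n] by auto
  with a b show "[a = b] (mod n) \<or> [a = - b] (mod n)"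
    by (meson cong_trans)
next
  assume "[a = b] (mod n) \<or> [a = - b] (mod n)"
  then show "cycle_dist n a = cycle_dist n b"
    using cycle_dist_cong[of a b n] cycle_dist_cong[of a "- b" n] by (auto simp: cycle_dist_minus)
qed

text \<open>A periodic indexing by all integers removes the wraparound: neighbours are always i - 1
  and i + 1.\<close>

locale cycle_indexing = pair_graph G for G :: "'a pair_pre_digraph" +
  fixes n :: nat and u :: "int \<Rightarrow> 'a"
  assumes n_ge_3: "n \<ge> 3"
    and verts_eq: "pverts G = range u"
    and u_eq_iff: "u i = u j \<longleftrightarrow> [i = j] (mod int n)"
    and arcs_eq: "parcs G = (\<Union>i. {(u i, u (i + 1)), (u (i + 1), u i)})"
begin

lemma verts_eq_image: "pverts G = u ` {0..<int n}"
proof -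
  have "u i \<in> u ` {0..<int n}" for i
    using n_ge_3 u_eq_iff[of i "i mod int n"] by (intro rev_image_eqI[of "i mod int n"]) auto
  then show ?thesis by (auto simp: verts_eq)
qed

lemma inj_on_u: "inj_on u {0..<int n}"
  by (auto simp: inj_on_def u_eq_iff cong_def)

lemma finite_verts: "finite (pverts G)"
  by (simp add: verts_eq_image)

lemma card_verts: "card (pverts G) = n"
  by (simp add: verts_eq_image card_image inj_on_u)

text \<open>Every arc shifts the index by 1 or -1, and t is the sum of these shifts. This bounds
  distances from below.\<close>

lemma awalk_displacement:
  assumes "awalk (u i) p (u j)"
  shows "\<exists>t. [j - i = t] (mod int n) \<and> \<bar>t\<bar> \<le> int (length p)"
  using assms
proof (induction p arbitrary: i)
  case Nil
  then have "[j = i] (mod int n)" by (auto simp: awalk_Nil_iff u_eq_iff cong_sym_eq)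
  then show ?case by (intro exI[of _ 0]) (auto simp: cong_iff_dvd_diff)
next
  case (Cons e p)
  from Cons.prems have e: "e \<in> parcs G" "u i = fst e" "awalk (snd e) p (u j)"
    by (auto simp: awalk_Cons_iff)
  \<comment> \<open>The index m of the tail agrees with i only modulo n. A backward arc is read as
    the step -1 from m + 1.\<close>
  from e(1) obtain m s where ms: "e = (u m, u (m + s))" "\<bar>s\<bar> = 1"
  proof -
    obtain m where "e = (u m, u (m + 1)) \<or> e = (u (m + 1), u (m + 1 + - 1))"
      using e(1) unfolding arcs_eq by auto
    then show ?thesis using that[of m 1] that[of "m + 1" "- 1"] by auto
  qed
  then obtain t where t: "[j - (m + s) = t] (mod int n)" "\<bar>t\<bar> \<le> int (length p)"
    using Cons.IH e(3) by auto
  from e(2) ms have "[i = m] (mod int n)" by (simp add: u_eq_iff)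
  then have "[j - i = t + s] (mod int n)"
    using t(1) cong_diff[of "j - (m + s)" t "int n" "i - m - s" "- s"]
    by (simp add: cong_iff_dvd_diff algebra_simps)
  then show ?case using t(2) ms(2) by (intro exI[of _ "t + s"]) auto
qed

text \<open>Walking steadily in direction s bounds distances from above. The walk may wind around
  and repeat vertices.\<close>

lemma ex_awalk_displacement:
  assumes "\<bar>s\<bar> = 1"
  shows "\<exists>p. awalk (u i) p (u (i + s * int l)) \<and> length p = l"
proof (induction l arbitrary: i)
  case 0
  then show ?case by (intro exI[of _ "[]"]) (auto simp: awalk_Nil_iff verts_eq)
next
  case (Suc l)
  then obtain p where p: "awalk (u (i + s)) p (u (i + s + s * int l))" "length p = l" by blast
  have "(u i, u (i + s)) \<in> parcs G"
  proof (cases "s = 1")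
    case True
    then show ?thesis by (auto simp: arcs_eq)
  next
    case False
    then have "s = - 1" using assms by auto
    then show ?thesis unfolding arcs_eq by (intro UN_I[of "i - 1"]) auto
  qed
  with p show ?case
    by (intro exI[of _ "(u i, u (i + s)) # p"]) (auto simp: awalk_Cons_iff algebra_simps)
qed

lemma graph_dist_eq: "graph_dist G (u i) (u j) = cycle_dist (int n) (j - i)"
  unfolding graph_dist_def
proof (rule Least_equality)
  let ?d = "cycle_dist (int n) (j - i)"
  have bound: "?d \<le> length p" if "awalk (u i) p (u j)" for p
    using awalk_displacement[OF that] cycle_dist_le by fastforce
  have "[j - i = 1 * int ?d] (mod int n) \<or> [j - i = (- 1) * int ?d] (mod int n)"
    using cycle_dist_attained[of "int n" "j - i"] n_ge_3 by simp
  then obtain s :: int where s: "\<bar>s\<bar> = 1" "[j - i = s * int ?d] (mod int n)"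
    using that[of 1] that[of "- 1"] by (metis abs_minus_cancel abs_one)
  then have "u j = u (i + s * int ?d)"
    by (simp add: u_eq_iff cong_iff_dvd_diff algebra_simps)
  with ex_awalk_displacement[OF s(1)] obtain p where "awalk (u i) p (u j)" "length p = ?d"
    by metis
  \<comment> \<open>Shortening to a path cannot go below \<open>?d\<close>, because the lower bound
    holds for all walks.\<close>
  then obtain q where q: "apath (u i) q (u j)" "length q \<le> ?d"
    using awalk_imp_shorter_apath by metis
  then have "length q = ?d"
    using bound awalkI_apath by (meson le_antisym)
  with q show "\<exists>p. apath (u i) p (u j) \<and> length p = ?d" by blast
  show "?d \<le> l" if "\<exists>p. apath (u i) p (u j) \<and> length p = l" for l
    using that bound awalkI_apath by blast
qed

section \<open>Resolving sets and the value of kappa\<close>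

lemma mem_resolving_set_iff:
  assumes "u i \<noteq> u j"
  shows "u z \<in> resolving_set G (u i) (u j) \<longleftrightarrow> \<not> [2 * z = i + j] (mod int n)"
proof -
  \<comment> \<open>Equal distances mean z - i = +-(z - j) modulo n; distinctness rules out the plus
    sign.\<close>
  have "\<not> [z - i = z - j] (mod int n)"
    using assms by (auto simp: u_eq_iff cong_iff_dvd_diff dvd_diff_commute)
  moreover have "[z - i = - (z - j)] (mod int n) \<longleftrightarrow> [2 * z = i + j] (mod int n)"
    by (simp add: cong_iff_dvd_diff algebra_simps)
  ultimately show ?thesis
    using n_ge_3
    by (simp add: resolving_set_def verts_eq graph_dist_eq cycle_dist_eq_iff)
qed

text \<open>For n = 2m the condition is z = a modulo m, and the range holds two periods of length m.
  For odd n, 2 is invertible. The gcd treats both parities uniformly.\<close>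

lemma card_double_cong: "card {z \<in> {0..<int n}. [2 * z = 2 * a] (mod int n)} = gcd 2 n"
proof (cases "even n")
  case True
  then obtain m where m: "n = 2 * m" by blast
  have "m > 0" using m n_ge_3 by auto
  have cong: "[2 * z = 2 * a] (mod int n) \<longleftrightarrow> [z = a] (mod int m)" for z
  proof -
    have "2 * z - 2 * a = 2 * (z - a)" "int n = 2 * int m" by (simp_all add: m)
    then show ?thesis by (simp only: cong_iff_dvd_diff dvd_mult_cancel_left) simp
  qed
  have "{z \<in> {0..<int n}. [2 * z = 2 * a] (mod int n)} = {a mod int m, a mod int m + int m}"
    (is "?A = ?B")
  proof (intro equalityI subsetI)
    fix z assume "z \<in> ?A"
    then have z: "0 \<le> z" "z < 2 * int m" "z mod int m = a mod int m"
      unfolding cong by (auto simp: m cong_def)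
    show "z \<in> ?B"
    proof (cases "z < int m")
      case True
      then show ?thesis using z by auto
    next
      case False
      then have "(z - int m) mod int m = z - int m"
        using z by (intro mod_pos_pos_trivial) auto
      then have "z mod int m = z - int m" by simp
      then show ?thesis using z by auto
    qed
  next
    fix z assume "z \<in> ?B"
    moreover have "0 \<le> a mod int m" "a mod int m < int m" using \<open>m > 0\<close> by auto
    ultimately show "z \<in> ?A" unfolding cong by (auto simp: m cong_def)
  qed
  then show ?thesis using True \<open>m > 0\<close> by (simp add: gcd_proj1_iff)
next
  case False
  then have "coprime 2 (int n)" by simp
  then have cong: "[2 * z = 2 * a] (mod int n) \<longleftrightarrow> [z = a] (mod int n)" for z
    by (intro cong_mult_lcancel)
  have "{z \<in> {0..<int n}. [2 * z = 2 * a] (mod int n)} = {a mod int n}"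
    unfolding cong using n_ge_3 by (auto simp: cong_def)
  then show ?thesis using False by (simp add: coprime_imp_gcd_eq_1)
qed

lemma card_not_double_cong:
  "card {z \<in> {0..<int n}. \<not> [2 * z = 2 * a] (mod int n)} = n - gcd 2 n"
proof -
  have "{z \<in> {0..<int n}. \<not> [2 * z = 2 * a] (mod int n)}
      = {0..<int n} - {z \<in> {0..<int n}. [2 * z = 2 * a] (mod int n)}" by auto
  also have "card \<dots> = n - card {z \<in> {0..<int n}. [2 * z = 2 * a] (mod int n)}"
    by (subst card_Diff_subset) (auto intro: finite_subset[of _ "{0..<int n}"])
  finally show ?thesis unfolding card_double_cong .
qed

lemma card_resolving_set:
  assumes "u i \<noteq> u j"
  shows "card (resolving_set G (u i) (u j)) = card {z \<in> {0..<int n}. \<not> [2 * z = i + j] (mod int n)}"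
proof -
  have "resolving_set G (u i) (u j) = u ` {z \<in> {0..<int n}. u z \<in> resolving_set G (u i) (u j)}"
    by (auto simp: resolving_set_def verts_eq_image)
  also have "\<dots> = u ` {z \<in> {0..<int n}. \<not> [2 * z = i + j] (mod int n)}"
    by (simp only: mem_resolving_set_iff[OF assms])
  also have "card \<dots> = card {z \<in> {0..<int n}. \<not> [2 * z = i + j] (mod int n)}"
    by (intro card_image inj_on_subset[OF inj_on_u]) auto
  finally show ?thesis .
qed

text \<open>If i + j is twice a residue, the previous count applies; otherwise every vertex resolves
  the pair.\<close>

lemma card_resolving_set_ge:
  assumes "u i \<noteq> u j"
  shows "n - gcd 2 n \<le> card (resolving_set G (u i) (u j))"
proof (cases "\<exists>a. [2 * a = i + j] (mod int n)")
  case True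
  then obtain a where "[2 * a = i + j] (mod int n)" by blast
  then have "[2 * z = i + j] (mod int n) \<longleftrightarrow> [2 * z = 2 * a] (mod int n)" for z
    by (simp add: cong_def)
  then show ?thesis unfolding card_resolving_set[OF assms] by (simp only: card_not_double_cong)
next
  case False
  then have "{z \<in> {0..<int n}. \<not> [2 * z = i + j] (mod int n)} = {0..<int n}" by auto
  then show ?thesis unfolding card_resolving_set[OF assms] by simp
qed

text \<open>These pairs have index sum 2i, the solvable case, so they attain the minimum
  \<open>kappa G\<close> and serve for the double counting.\<close>

lemma neighbours_distinct: "u (i - 1) \<noteq> u (i + 1)"
proof
  assume "u (i - 1) = u (i + 1)"
  then have "int n dvd - 2" by (simp add: u_eq_iff cong_iff_dvd_diff)
  then show False using n_ge_3 zdvd_imp_le[of "int n" 2] by simp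
qed

lemma kappa_eq: "kappa G = n - gcd 2 n"
proof (rule antisym)
  have "kappa G \<le> card (resolving_set G (u (0 - 1)) (u (0 + 1)))"
    by (rule kappa_le_card_resolving_set[OF finite_verts _ _ neighbours_distinct])
      (auto simp: verts_eq)
  also have "\<dots> = n - gcd 2 n"
    unfolding card_resolving_set[OF neighbours_distinct] using card_not_double_cong[of 0] by simp
  finally show "kappa G \<le> n - gcd 2 n" .
next
  let ?S = "{card (resolving_set G x y) | x y. x \<in> pverts G \<and> y \<in> pverts G \<and> x \<noteq> y}"
  have "finite ?S" using finite_card_resolving_sets[OF finite_verts] .
  \<comment> \<open>Nonemptiness ensures that \<open>Min\<close> is attained, so the bound for every
    pair passes to \<open>kappa G\<close>.\<close>
  moreover have "?S \<noteq> {}" using neighbours_distinct by (auto simp: verts_eq)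
  ultimately have "kappa G \<in> ?S" unfolding kappa_def by (rule Min_in)
  then show "n - gcd 2 n \<le> kappa G" using card_resolving_set_ge by (auto simp: verts_eq)
qed

section \<open>Fractional dimension of an indexed cycle\<close>

lemma frac_k_metric_dim_cycle:
  assumes "k \<in> {1..real n - gcd 2 n}"
  shows "frac_k_metric_dim G k = k * n / (real n - gcd 2 n)"
proof -
  \<comment> \<open>The natural-number subtraction in \<open>kappa_eq\<close> does not
    truncate.\<close>
  have "gcd 2 n \<le> n" using n_ge_3 by (intro gcd_le2_nat) auto
  then have kappa: "real (kappa G) = real n - gcd 2 n" by (simp add: kappa_eq of_nat_diff)
  have "frac_k_metric_dim G k = k * card (pverts G) / kappa G"
  proof (rule frac_k_metric_dim_eq[where I = "{0..<int n}"
        and x = "\<lambda>i. u (i - 1)" and y = "\<lambda>i. u (i + 1)"])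
    fix w assume "w \<in> pverts G"
    then obtain j where w: "w = u j" by (auto simp: verts_eq)
    \<comment> \<open>The congruence 2i = 2j is symmetric, so counting pairs per vertex repeats the
      count of vertices per pair.\<close>
    have "{i \<in> {0..<int n}. w \<in> resolving_set G (u (i - 1)) (u (i + 1))}
        = {i \<in> {0..<int n}. \<not> [2 * i = 2 * j] (mod int n)}"
      by (auto simp: w mem_resolving_set_iff neighbours_distinct cong_sym_eq)
    then show "card {i \<in> {0..<int n}. w \<in> resolving_set G (u (i - 1)) (u (i + 1))} = kappa G"
      by (simp only: card_not_double_cong kappa_eq)
  qed (use assms in \<open>auto simp: finite_verts card_verts kappa neighbours_distinct\<close>, auto simp: verts_eq)
  then show ?thesis by (simp add: card_verts kappa)
qed

end

section \<open>Integer indexing of an arbitrary n-cycle\<close>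

lemma is_n_cycle_imp_cycle_indexing:
  assumes "n \<ge> 3" "is_n_cycle n G"
  shows "\<exists>u. cycle_indexing G n u"
proof -
  from assms(2) obtain v where G: "pair_graph G" and v: "bij_betw v {..<n} (pverts G)"
    and arcs: "parcs G = (\<Union>i<n. {(v i, v (Suc i mod n)), (v (Suc i mod n), v i)})"
    unfolding is_n_cycle_def by blast
  define r where "r i = nat (i mod int n)" for i
  have r_lt: "r i < n" for i using assms(1) by (simp add: r_def nat_less_iff)
  have r_Suc: "r (i + 1) = Suc (r i) mod n" for i
  proof -
    have "int (r (i + 1)) = int (Suc (r i) mod n)"
      using assms(1) by (simp add: r_def zmod_int add.commute mod_simps)
    then show ?thesis by linarith
  qed
  have r_nat: "r (int i) = i" if "i < n" for i
    using that by (simp add: r_def)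
  have range_r: "range r = {..<n}"
    using r_lt r_nat by (auto simp: image_iff) metis
  have "cycle_indexing G n (v \<circ> r)"
  proof (intro cycle_indexing.intro G cycle_indexing_axioms.intro assms(1))
    show "pverts G = range (v \<circ> r)"
      using v by (simp add: bij_betw_def range_r flip: image_image image_comp)
    show "(v \<circ> r) i = (v \<circ> r) j \<longleftrightarrow> [i = j] (mod int n)" for i j
    proof -
      have "(v \<circ> r) i = (v \<circ> r) j \<longleftrightarrow> r i = r j"
        using v r_lt by (auto simp: bij_betw_def inj_on_def)
      also have "\<dots> \<longleftrightarrow> [i = j] (mod int n)"
        using assms(1) by (simp add: r_def cong_def eq_nat_nat_iff)
      finally show ?thesis .
    qed
    \<comment> \<open>As r maps onto all of {0, ..., n - 1}, the union can be reindexed over the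
      integers; \<open>r_Suc\<close> then absorbs the wraparound.\<close>
    have "parcs G = (\<Union>i\<in>range r. {(v i, v (Suc i mod n)), (v (Suc i mod n), v i)})"
      by (simp only: arcs range_r)
    then show "parcs G = (\<Union>i. {((v \<circ> r) i, (v \<circ> r) (i + 1)), ((v \<circ> r) (i + 1), (v \<circ> r) i)})"
      by (simp add: r_Suc)
  qed
  then show ?thesis by blast
qed

theorem proposition4p7:
  fixes C :: "'a pair_pre_digraph" and n :: nat and k :: real
  assumes "n \<ge> 3" and "is_n_cycle n C"
  shows "(even n \<and> k \<in> {1..real n - 2} \<longrightarrow>
            frac_k_metric_dim C k = k * frac_metric_dim C \<and>
            k * frac_metric_dim C = k * real n / (real n - 2)) \<and>
         (odd n \<and> k \<in> {1..real n - 1} \<longrightarrow>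
            frac_k_metric_dim C k = k * frac_metric_dim C \<and>
            k * frac_metric_dim C = k * real n / (real n - 1))"
proof -
  obtain u where "cycle_indexing C n u"
    using is_n_cycle_imp_cycle_indexing[OF assms] by blast
  then interpret cycle_indexing C n u .
  have gcd: "gcd 2 n = (if even n then 2 else 1)"
    by (auto simp: gcd_proj1_iff coprime_imp_gcd_eq_1)
  have "frac_k_metric_dim C k = k * real n / (real n - gcd 2 n)
      \<and> frac_k_metric_dim C 1 = real n / (real n - gcd 2 n)"
    if "k \<in> {1..real n - gcd 2 n}"
    \<comment> \<open>The value 1 is admissible because the interval contains k.\<close>
    using frac_k_metric_dim_cycle[OF that] frac_k_metric_dim_cycle[of 1] that by auto
  then show ?thesis
    by (auto simp: frac_metric_dim_def gcd)
qed

end
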